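(* Let $B$ be the Boolean ring of measurable subsets of $[0,1]$ modulo sets of measure zero, with the metric $d([S],[T])=\mu(S+T)$. Then $B$ is a commutative topological ring under the topology of $d$, and is complete as a metric space under $d$; one has $\sqrt{\{0\}}=\{0\}$; and $B$ has no closed prime ideals. Hence $\sqrt{\{0\}}$ is not the intersection of the closed prime ideals of $B$ containing $\{0\}$ (the intersection of the empty family of ideals being $B$ itself). In particular, it is not true that in every complete topological commutative ring $R$, for every ideal $I$, the ideal $\sqrt I$ is the intersection of all closed prime ideals of $R$ containing $I$.
   Context: Let $\mu$ be Lebesgue measure on $[0,1]$ and $B_0$ the set of Lebesgue measurable subsets of $[0,1]$, a Boolean ring under $0=\emptyset$, $1=[0,1]$, $S+T=(S\cup T)\setminus(S\cap T)$, $ST=S\cap T$. Let $B=B_0/\{S\in B_0\mid \mu(S)=0\}$, and write $[S]$ for the image in $B$ of $S\in B_0$. The formula $d([S],[T])=\mu(S+T)$ gives a well-defined metric on $B$, which is invariant under additive translation. For an ideal $I$ of a topological commutative ring $R$, $\sqrt I$ denotes the least closed ideal $J\supseteq I$ such that $J$ contains every $x\in R$ for which $x^n\in J$ for some $n\ge 1$. Completeness of a topological ring refers to the uniform structure given by additive translates of neighborhoods of $0$; for $B$ this is equivalent to completeness in the metric $d$. *)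

theory Defs
  imports "HOL-Analysis.Analysis" "HOL-Algebra.QuotRing"
begin

section \<open>Topological commutative rings\<close>

definition topological_cring :: "('a, 'm) ring_scheme \<Rightarrow> 'a topology \<Rightarrow> bool" where
  "topological_cring R T \<longleftrightarrow>
     cring R \<and> topspace T = carrier R \<and>
     continuous_map (prod_topology T T) T (\<lambda>(x, y). x \<oplus>\<^bsub>R\<^esub> y) \<and>
     continuous_map T T (\<lambda>x. \<ominus>\<^bsub>R\<^esub> x) \<and>
     continuous_map (prod_topology T T) T (\<lambda>(x, y). x \<otimes>\<^bsub>R\<^esub> y)"

text \<open>Completeness of the additive uniformity, whose basic entourages are
  the sets of pairs \<open>(x, y)\<close> with \<open>x - y\<close> in \<open>U\<close>, for \<open>U\<close> an open neighbourhood of \<open>0\<close>: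
  every Cauchy filter converges. Limits are not required to be unique.\<close>

definition ring_cauchy_filter :: "('a, 'm) ring_scheme \<Rightarrow> 'a topology \<Rightarrow> 'a filter \<Rightarrow> bool" where
  "ring_cauchy_filter R T F \<longleftrightarrow>
     F \<noteq> bot \<and> (\<forall>\<^sub>F x in F. x \<in> carrier R) \<and>
     (\<forall>U. openin T U \<and> \<zero>\<^bsub>R\<^esub> \<in> U \<longrightarrow> (\<forall>\<^sub>F (x, y) in F \<times>\<^sub>F F. x \<ominus>\<^bsub>R\<^esub> y \<in> U))"

definition complete_topological_cring :: "('a, 'm) ring_scheme \<Rightarrow> 'a topology \<Rightarrow> bool" where
  "complete_topological_cring R T \<longleftrightarrow>
     topological_cring R T \<and>
     (\<forall>F. ring_cauchy_filter R T F \<longrightarrow> (\<exists>l. limitin T (\<lambda>x. x) l F))"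

definition closed_radical_ideal :: "('a, 'm) ring_scheme \<Rightarrow> 'a topology \<Rightarrow> 'a set \<Rightarrow> bool" where
  "closed_radical_ideal R T J \<longleftrightarrow>
     ideal J R \<and> closedin T J \<and>
     (\<forall>x\<in>carrier R. (\<exists>n::nat\<ge>1. x [^]\<^bsub>R\<^esub> n \<in> J) \<longrightarrow> x \<in> J)"

definition closed_radical :: "('a, 'm) ring_scheme \<Rightarrow> 'a topology \<Rightarrow> 'a set \<Rightarrow> 'a set" where
  "closed_radical R T I = closed_radical_ideal R T hull I"

text \<open>The hull is an intersection over a nonempty family, hence really the least such ideal.\<close>

lemma closed_radical_least:
  assumes "topological_cring R T" "ideal I R"
  shows "closed_radical_ideal R T (closed_radical R T I)"
    and "I \<subseteq> closed_radical R T I"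
    and "\<And>J. closed_radical_ideal R T J \<Longrightarrow> I \<subseteq> J \<Longrightarrow> closed_radical R T I \<subseteq> J"
proof -
  interpret cring R using assms(1) by (simp add: topological_cring_def)
  let ?S = "{J. closed_radical_ideal R T J \<and> I \<subseteq> J}"
  have "closedin T (carrier R)"
    using assms(1) by (metis closedin_topspace topological_cring_def)
  then have car: "carrier R \<in> ?S"
    using oneideal ideal.Icarr[OF assms(2)] by (auto simp: closed_radical_ideal_def)
  have "ideal (\<Inter>?S) R"
    by (rule i_Intersect) (use car in \<open>auto simp: closed_radical_ideal_def\<close>)
  moreover have "closedin T (\<Inter>?S)"
    by (rule closedin_Inter) (use car in \<open>auto simp: closed_radical_ideal_def\<close>)
  ultimately show "closed_radical_ideal R T (closed_radical R T I)"
    unfolding closed_radical_def hull_def closed_radical_ideal_def by blast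
  show "I \<subseteq> closed_radical R T I"
    unfolding closed_radical_def by (rule hull_subset)
  show "\<And>J. closed_radical_ideal R T J \<Longrightarrow> I \<subseteq> J \<Longrightarrow> closed_radical R T I \<subseteq> J"
    unfolding closed_radical_def by (rule hull_minimal)
qed

definition closed_prime_ideal :: "('a, 'm) ring_scheme \<Rightarrow> 'a topology \<Rightarrow> 'a set \<Rightarrow> bool" where
  "closed_prime_ideal R T P \<longleftrightarrow> primeideal P R \<and> closedin T P"

text \<open>Intersecting with the carrier makes the intersection of the empty family the whole ring.\<close>

definition closed_prime_intersection ::
    "('a, 'm) ring_scheme \<Rightarrow> 'a topology \<Rightarrow> 'a set \<Rightarrow> 'a set" where
  "closed_prime_intersection R T I =
     carrier R \<inter> \<Inter>{P. closed_prime_ideal R T P \<and> I \<subseteq> P}"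


section \<open>The ring of measurable sets modulo null sets\<close>

definition meas_ring :: "real set ring" where
  "meas_ring =
     \<lparr>carrier = sets (lebesgue_on {0..1}), mult = (\<inter>), one = {0..1},
      zero = {}, add = sym_diff\<rparr>"

definition null_ideal :: "real set set" where
  "null_ideal = {S \<in> carrier meas_ring. measure (lebesgue_on {0..1}) S = 0}"

definition meas_alg :: "real set set ring" where
  "meas_alg = meas_ring Quot null_ideal"

definition meas_class :: "real set \<Rightarrow> real set set" where
  "meas_class S = null_ideal +>\<^bsub>meas_ring\<^esub> S"

text \<open>The choice of representatives is immaterial, see \<open>meas_dist_class\<close> below.\<close>

definition meas_dist :: "real set set \<Rightarrow> real set set \<Rightarrow> real" where
  "meas_dist X Y =
     measure (lebesgue_on {0..1}) ((SOME S. S \<in> X) \<oplus>\<^bsub>meas_ring\<^esub> (SOME T. T \<in> Y))"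

definition meas_topology :: "real set set topology" where
  "meas_topology = Metric_space.mtopology (carrier meas_alg) meas_dist"

lemma meas_ring_simps:
  "carrier meas_ring = sets (lebesgue_on {0..1})"
  "S \<otimes>\<^bsub>meas_ring\<^esub> T = S \<inter> T" "S \<oplus>\<^bsub>meas_ring\<^esub> T = sym_diff S T"
  "\<one>\<^bsub>meas_ring\<^esub> = {0..1}" "\<zero>\<^bsub>meas_ring\<^esub> = {}"
  by (simp_all add: meas_ring_def)

lemma cring_meas_ring: "cring meas_ring"
proof (rule cringI)
  have top: "{0..1} \<in> sets (lebesgue_on {0..1::real})"
    using sets.top[of "lebesgue_on {0..1::real}"] by simp
  show "abelian_group meas_ring"
    by (rule abelian_groupI) (auto simp: meas_ring_simps)
  have sub: "S \<subseteq> {0..1}" if "S \<in> sets (lebesgue_on {0..1::real})" for S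
    using sets.sets_into_space[OF that] by simp
  show "comm_monoid meas_ring"
    by (rule comm_monoidI)
      (simp_all add: meas_ring_simps top sub sets.Int Int_ac Int_absorb1 Int_absorb2)
qed (auto simp: meas_ring_simps)

lemma fin_meas: "emeasure (lebesgue_on {0..1::real}) S \<noteq> \<infinity>"
proof -
  interpret finite_measure "lebesgue_on {0..1::real}"
    by (rule finite_measure_lebesgue_on) simp
  show ?thesis by simp
qed

lemma null_ideal_altdef: "null_ideal = null_sets (lebesgue_on {0..1::real})"
  using fin_meas by (auto simp: null_ideal_def null_sets_def meas_ring_simps measure_def enn2real_eq_0_iff)

lemma ideal_null_ideal: "ideal null_ideal meas_ring"
proof -
  interpret cring meas_ring by (rule cring_meas_ring)
  have inv: "\<ominus>\<^bsub>meas_ring\<^esub> S = S" if "S \<in> carrier meas_ring" for S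
    by (rule minus_equality) (use that in \<open>simp_all add: meas_ring_simps\<close>)
  show ?thesis
  proof (rule idealI[OF ring_axioms])
    show "subgroup null_ideal (add_monoid meas_ring)"
    proof (rule add.subgroupI)
      fix S assume "S \<in> null_ideal"
      then show "\<ominus>\<^bsub>meas_ring\<^esub> S \<in> null_ideal"
        using inv[of S] by (simp add: null_ideal_def)
    next
      fix S T assume "S \<in> null_ideal" "T \<in> null_ideal"
      then show "S \<oplus>\<^bsub>meas_ring\<^esub> T \<in> null_ideal"
        unfolding null_ideal_altdef meas_ring_simps
        by (intro null_sets.Un null_set_Diff) (simp_all add: null_setsD2)
    next
      show "null_ideal \<subseteq> carrier meas_ring" by (auto simp: null_ideal_def)
      have "{} \<in> null_ideal" by (simp add: null_ideal_def meas_ring_simps)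
      then show "null_ideal \<noteq> {}" by blast
    qed
  next
    fix S T assume "S \<in> null_ideal" "T \<in> carrier meas_ring"
    then show "T \<otimes>\<^bsub>meas_ring\<^esub> S \<in> null_ideal" "S \<otimes>\<^bsub>meas_ring\<^esub> T \<in> null_ideal"
      unfolding null_ideal_altdef meas_ring_simps
      by (simp_all only: null_set_Int1 null_set_Int2)
  qed
qed

lemma meas_alg_carrier: "carrier meas_alg = meas_class ` carrier meas_ring"
  by (auto simp: meas_alg_def FactRing_def A_RCOSETS_def' meas_class_def)

lemma meas_class_eq_iff:
  assumes "S \<in> carrier meas_ring" "T \<in> carrier meas_ring"
  shows "meas_class S = meas_class T \<longleftrightarrow> measure (lebesgue_on {0..1}) (S \<oplus>\<^bsub>meas_ring\<^esub> T) = 0"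
proof -
  interpret cring meas_ring by (rule cring_meas_ring)
  interpret ideal null_ideal meas_ring by (rule ideal_null_ideal)
  have "\<ominus>\<^bsub>meas_ring\<^esub> T = T"
    by (rule minus_equality) (use assms in \<open>simp_all add: meas_ring_simps\<close>)
  then have "S \<ominus>\<^bsub>meas_ring\<^esub> T = S \<oplus>\<^bsub>meas_ring\<^esub> T"
    by (simp add: a_minus_def)
  moreover have "S \<oplus>\<^bsub>meas_ring\<^esub> T \<in> carrier meas_ring" using assms by simp
  ultimately have "S \<ominus>\<^bsub>meas_ring\<^esub> T \<in> null_ideal \<longleftrightarrow>
      measure (lebesgue_on {0..1}) (S \<oplus>\<^bsub>meas_ring\<^esub> T) = 0"
    by (simp only: null_ideal_def mem_Collect_eq simp_thms)
  then show ?thesis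
    unfolding meas_class_def using quotient_eq_iff_same_a_r_cos[OF ideal_null_ideal assms] by blast
qed

lemma measure_sym_diff_triangle:
  assumes "S \<in> carrier meas_ring" "T \<in> carrier meas_ring" "U \<in> carrier meas_ring"
  shows "measure (lebesgue_on {0..1}) (S \<oplus>\<^bsub>meas_ring\<^esub> U)
    \<le> measure (lebesgue_on {0..1}) (S \<oplus>\<^bsub>meas_ring\<^esub> T)
      + measure (lebesgue_on {0..1}) (T \<oplus>\<^bsub>meas_ring\<^esub> U)"
proof -
  interpret finite_measure "lebesgue_on {0..1::real}"
    by (rule finite_measure_lebesgue_on) simp
  have "measure (lebesgue_on {0..1}) (sym_diff S U)
      \<le> measure (lebesgue_on {0..1}) (sym_diff S T \<union> sym_diff T U)"
    by (rule finite_measure_mono) (use assms in \<open>auto simp: meas_ring_simps\<close>)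
  also have "\<dots> \<le> measure (lebesgue_on {0..1}) (sym_diff S T)
      + measure (lebesgue_on {0..1}) (sym_diff T U)"
    by (rule measure_Un_le) (use assms in \<open>auto simp: meas_ring_simps\<close>)
  finally show ?thesis by (simp add: meas_ring_simps)
qed

lemma meas_class_repr:
  assumes "S \<in> carrier meas_ring"
  shows "(SOME S'. S' \<in> meas_class S) \<in> carrier meas_ring"
    and "meas_class (SOME S'. S' \<in> meas_class S) = meas_class S"
proof -
  interpret cring meas_ring by (rule cring_meas_ring)
  interpret ideal null_ideal meas_ring by (rule ideal_null_ideal)
  have "S \<in> meas_class S"
    unfolding meas_class_def using assms by (rule a_rcos_self)
  then have in_class: "(SOME S'. S' \<in> meas_class S) \<in> meas_class S" by (rule someI)
  have "meas_class S \<subseteq> carrier meas_ring"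
    unfolding meas_class_def using a_subset assms by (rule a_r_coset_subset_G)
  with in_class show "(SOME S'. S' \<in> meas_class S) \<in> carrier meas_ring" by blast
  show "meas_class (SOME S'. S' \<in> meas_class S) = meas_class S"
    using a_repr_independence[OF in_class[unfolded meas_class_def] assms a_subgroup]
    by (simp add: meas_class_def)
qed

lemma meas_dist_class:
  assumes S: "S \<in> carrier meas_ring" and T: "T \<in> carrier meas_ring"
  shows "meas_dist (meas_class S) (meas_class T)
    = measure (lebesgue_on {0..1}) (S \<oplus>\<^bsub>meas_ring\<^esub> T)"
proof -
  have le: "measure (lebesgue_on {0..1}) (A \<oplus>\<^bsub>meas_ring\<^esub> B)
      \<le> measure (lebesgue_on {0..1}) (A' \<oplus>\<^bsub>meas_ring\<^esub> B')"
    if AB: "A \<in> carrier meas_ring" "B \<in> carrier meas_ring"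
       "A' \<in> carrier meas_ring" "B' \<in> carrier meas_ring"
       and eq: "meas_class A = meas_class A'" "meas_class B = meas_class B'" for A B A' B'
  proof -
    have "measure (lebesgue_on {0..1}) (A \<oplus>\<^bsub>meas_ring\<^esub> A') = 0"
      using meas_class_eq_iff[OF AB(1,3)] eq by simp
    moreover have "measure (lebesgue_on {0..1}) (B' \<oplus>\<^bsub>meas_ring\<^esub> B) = 0"
      using meas_class_eq_iff[OF AB(4,2)] eq by simp
    ultimately show ?thesis
      using measure_sym_diff_triangle[OF AB(1,3,2)] measure_sym_diff_triangle[OF AB(3,4,2)]
      by linarith
  qed
  note S' = meas_class_repr[OF S] and T' = meas_class_repr[OF T]
  show ?thesis
    unfolding meas_dist_def
    using le[OF S'(1) T'(1) S T S'(2) T'(2)]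
      le[OF S T S'(1) T'(1) S'(2)[symmetric] T'(2)[symmetric]]
    by (rule order_antisym)
qed

lemma Metric_space_meas_alg: "Metric_space (carrier meas_alg) meas_dist"
proof
  show "0 \<le> meas_dist X Y" for X Y
    by (simp add: meas_dist_def)
  show "meas_dist X Y = meas_dist Y X" for X Y
    by (simp add: meas_dist_def meas_ring_simps Un_commute)
  show "meas_dist X Y = 0 \<longleftrightarrow> X = Y" if "X \<in> carrier meas_alg" "Y \<in> carrier meas_alg" for X Y
    using that unfolding meas_alg_carrier
    by (elim imageE) (simp only: meas_dist_class meas_class_eq_iff)
  show "meas_dist X Z \<le> meas_dist X Y + meas_dist Y Z"
    if "X \<in> carrier meas_alg" "Y \<in> carrier meas_alg" "Z \<in> carrier meas_alg" for X Y Z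
    using that measure_sym_diff_triangle
    by (auto simp only: meas_alg_carrier meas_dist_class)
qed

end

theory Submission
  imports Defs
begin

text \<open>A prime ideal of \<open>B\<close> contains one of \<open>x\<close> and \<open>1 - x\<close> for each \<open>x\<close>. Repeated halving produces
  intervals \<open>S\<^sub>n\<close> of length at most \<open>2\<^sup>-\<^sup>n\<close> whose classes lie outside a given prime ideal \<open>P\<close>; so \<open>P\<close>
  contains the classes of the complements, which converge to \<open>1\<close>. A closed \<open>P\<close> would thus contain
  \<open>1\<close>. Completeness is the Borel--Cantelli argument: if \<open>\<mu>(S\<^sub>n + S\<^sub>n\<^sub>+\<^sub>1) \<le> 2\<^sup>-\<^sup>n\<close>, then \<open>S\<^sub>n\<close> converges to
  \<open>lim sup S\<^sub>n\<close>.\<close>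

section \<open>Completeness and continuity criteria in metric spaces\<close>

context Metric_space
begin

text \<open>A Cauchy sequence converges as soon as one of its subsequences does, and a subsequence
  can be chosen whose successive distances decay geometrically. Summable steps are what the later
  limit superior argument needs.\<close>

lemma mcompleteI_fast:
  assumes "\<And>\<sigma>. range \<sigma> \<subseteq> M \<Longrightarrow> (\<And>n. d (\<sigma> n) (\<sigma> (Suc n)) \<le> (1/2) ^ n) \<Longrightarrow>
             \<exists>l. limitin mtopology \<sigma> l sequentially"
  shows mcomplete
  unfolding mcomplete_def
proof (intro allI impI)
  fix \<sigma> assume cau: "MCauchy \<sigma>"
  have "\<exists>N. \<forall>m\<ge>N. \<forall>m'\<ge>N. d (\<sigma> m) (\<sigma> m') < (1/2) ^ n" for n
    using cau unfolding MCauchy_def by (meson zero_less_power half_gt_zero zero_less_one)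
  then obtain N where N: "\<And>n m m'. N n \<le> m \<Longrightarrow> N n \<le> m' \<Longrightarrow> d (\<sigma> m) (\<sigma> m') < (1/2) ^ n"
    by metis
  \<comment> \<open>Summing \<open>Suc (N k)\<close> over all \<open>k\<close> up to
    \<open>n\<close> gives at once \<open>r n\<close> \<ge> \<open>N n\<close> and strict growth,
    although \<open>N\<close> itself need not be monotone.\<close>
  define r where "r n = (\<Sum>k\<le>n. Suc (N k))" for n
  have r: "N n \<le> r n" "r n < r (Suc n)" for n
    unfolding r_def by (cases n) auto
  have "range (\<sigma> \<circ> r) \<subseteq> M"
    using cau by (auto simp: MCauchy_def)
  moreover have "d ((\<sigma> \<circ> r) n) ((\<sigma> \<circ> r) (Suc n)) \<le> (1/2) ^ n" for n
    using N[of n "r n" "r (Suc n)"] r[of n] by simp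
  ultimately obtain l where "limitin mtopology (\<sigma> \<circ> r) l sequentially"
    using assms by blast
  then show "\<exists>l. limitin mtopology \<sigma> l sequentially"
    using MCauchy_convergent_subsequence[OF cau] r(2) strict_mono_Suc_iff by blast
qed

text \<open>Bridges completeness by sequences and completeness by filters. The metric uniformity has
  a countable base, so a Cauchy filter contains sets \<open>P n\<close> of diameter tending to 0;
  points picked from them form a Cauchy sequence, and its limit is a limit of the filter.\<close>

lemma mcomplete_imp_cauchy_filter_converges:
  assumes compl: mcomplete
    and nontriv: "F \<noteq> bot"
    and cau: "\<And>\<epsilon>. \<epsilon> > 0 \<Longrightarrow> \<forall>\<^sub>F (x, y) in F \<times>\<^sub>F F. x \<in> M \<and> y \<in> M \<and> d x y < \<epsilon>"
  shows "\<exists>l. limitin mtopology (\<lambda>x. x) l F"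
proof -
  have "\<exists>P. eventually P F \<and> (\<forall>x y. P x \<longrightarrow> P y \<longrightarrow> x \<in> M \<and> y \<in> M \<and> d x y < inverse (Suc n))" for n
    using cau[of "inverse (Suc n)"] by (simp add: eventually_prod_same)
  then obtain P where P: "\<And>n. eventually (P n) F"
    and Pd: "\<And>n x y. P n x \<Longrightarrow> P n y \<Longrightarrow> x \<in> M \<and> y \<in> M \<and> d x y < inverse (Suc n)"
    by metis
  have "\<forall>\<^sub>F x in F. \<forall>k\<in>{..n}. P k x" for n
    using P by (simp add: eventually_ball_finite)
  then have "\<exists>x. \<forall>k\<in>{..n}. P k x" for n
    using nontriv eventually_happens by blast
  \<comment> \<open>Picking \<open>\<sigma> n\<close> in all of \<open>P 0\<close>, ...,
    \<open>P n\<close> replaces nestedness of the sets: any two terms with index at least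
    \<open>N\<close> lie together in \<open>P N\<close>.\<close>
  then obtain \<sigma> where \<sigma>: "\<And>n k. k \<le> n \<Longrightarrow> P k (\<sigma> n)"
    by (metis atMost_iff)
  have "MCauchy \<sigma>"
    unfolding MCauchy_def
  proof (intro conjI allI impI)
    show "range \<sigma> \<subseteq> M" using \<sigma> Pd by blast
    fix \<epsilon> :: real assume "\<epsilon> > 0"
    then obtain N where N: "inverse (Suc N) < \<epsilon>" using reals_Archimedean by blast
    show "\<exists>N. \<forall>n n'. N \<le> n \<longrightarrow> N \<le> n' \<longrightarrow> d (\<sigma> n) (\<sigma> n') < \<epsilon>"
      using Pd[OF \<sigma> \<sigma>] N by (meson less_trans)
  qed
  then obtain l where l: "limitin mtopology \<sigma> l sequentially"
    using compl unfolding mcomplete_def by blast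
  then have lM: "l \<in> M" by (rule limitin_mspace)
  have "\<forall>\<^sub>F x in F. x \<in> M \<and> d x l < \<epsilon>" if "\<epsilon> > 0" for \<epsilon>
  proof -
    obtain N where N: "inverse (Suc N) < \<epsilon> / 2" using \<open>\<epsilon> > 0\<close> reals_Archimedean half_gt_zero by blast
    obtain K where K: "\<And>n. n \<ge> K \<Longrightarrow> \<sigma> n \<in> M \<and> d (\<sigma> n) l < \<epsilon> / 2"
      using l \<open>\<epsilon> > 0\<close> unfolding limit_metric_sequentially by (meson half_gt_zero)
    show ?thesis
      using P[of N]
    proof eventually_elim
      case (elim x)
      \<comment> \<open>An index at least \<open>N\<close> places the term in \<open>P N\<close>,
        close to \<open>x\<close>; an index at least \<open>K\<close> places it close to
        \<open>l\<close>.\<close>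
      have "P N (\<sigma> (max N K))" by (rule \<sigma>) simp
      with elim have "x \<in> M" "d x (\<sigma> (max N K)) < inverse (Suc N)"
        using Pd by blast+
      moreover have "\<sigma> (max N K) \<in> M" "d (\<sigma> (max N K)) l < \<epsilon> / 2"
        using K by auto
      ultimately show ?case
        using triangle[of x "\<sigma> (max N K)" l] lM N by linarith
    qed
  qed
  then show ?thesis
    using lM limitin_metric by blast
qed

text \<open>Splitting \<epsilon> equally between the two coordinates yields a product of balls that
  is mapped into the \<epsilon>-ball. One criterion thereby serves both addition and
  multiplication.\<close>

lemma continuous_map_prod_nonexpansive:
  assumes closed: "\<And>x y. x \<in> M \<Longrightarrow> y \<in> M \<Longrightarrow> f x y \<in> M"
    and le: "\<And>x y x' y'. \<lbrakk>x \<in> M; y \<in> M; x' \<in> M; y' \<in> M\<rbrakk> \<Longrightarrow> d (f x y) (f x' y') \<le> d x x' + d y y'"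
  shows "continuous_map (prod_topology mtopology mtopology) mtopology (\<lambda>(x, y). f x y)"
  unfolding continuous_map_to_metric
proof (intro ballI allI impI)
  fix p and \<epsilon> :: real
  assume "p \<in> topspace (prod_topology mtopology mtopology)" and "\<epsilon> > 0"
  then obtain x y where p: "p = (x, y)" "x \<in> M" "y \<in> M" by auto
  let ?U = "mball x (\<epsilon> / 2) \<times> mball y (\<epsilon> / 2)"
  have "openin (prod_topology mtopology mtopology) ?U"
    by (simp add: openin_prod_Times_iff)
  moreover have "p \<in> ?U"
    using p \<open>\<epsilon> > 0\<close> by simp
  moreover have "(case q of (x, y) \<Rightarrow> f x y) \<in> mball (case p of (x, y) \<Rightarrow> f x y) \<epsilon>" if "q \<in> ?U" for q
    using that p closed le[of x y "fst q" "snd q"] by (auto simp: case_prod_beta)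
  ultimately show "\<exists>U. openin (prod_topology mtopology mtopology) U \<and> p \<in> U \<and>
      (\<forall>q\<in>U. (case q of (x, y) \<Rightarrow> f x y) \<in> mball (case p of (x, y) \<Rightarrow> f x y) \<epsilon>)"
    by blast
qed

end

section \<open>Arithmetic of the quotient ring through representatives\<close>

abbreviation mu :: "real set \<Rightarrow> real" where
  "mu \<equiv> measure (lebesgue_on {0..1})"

interpretation mu: finite_measure "lebesgue_on {0..1::real}"
  by (rule finite_measure_lebesgue_on) simp

interpretation MR: cring meas_ring
  by (rule cring_meas_ring)

interpretation MA: cring meas_alg
  unfolding meas_alg_def by (rule ideal.quotient_is_cring[OF ideal_null_ideal cring_meas_ring])

interpretation MA: Metric_space "carrier meas_alg" meas_dist
  by (rule Metric_space_meas_alg)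

interpretation mc: ring_hom_cring meas_ring meas_alg meas_class
  unfolding meas_alg_def meas_class_def[abs_def]
  by (rule ideal.rcos_ring_hom_cring[OF ideal_null_ideal cring_meas_ring])

lemma meas_ring_top: "{0..1} \<in> carrier meas_ring"
  using MR.one_closed by (simp add: meas_ring_simps)

lemma meas_ring_subset: "S \<in> carrier meas_ring \<Longrightarrow> S \<subseteq> {0..1}"
  using sets.sets_into_space[of S "lebesgue_on {0..1::real}"] by (simp add: meas_ring_simps)

lemma meas_alg_cases:
  assumes "X \<in> carrier meas_alg"
  obtains S where "S \<in> carrier meas_ring" "X = meas_class S"
  using assms by (auto simp: meas_alg_carrier)

lemma meas_class_Int:
  "S \<in> carrier meas_ring \<Longrightarrow> T \<in> carrier meas_ring \<Longrightarrow>
    meas_class S \<otimes>\<^bsub>meas_alg\<^esub> meas_class T = meas_class (S \<inter> T)"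
  using mc.hom_mult[of S T] by (simp add: meas_ring_simps(2))

lemma meas_class_sym_diff:
  "S \<in> carrier meas_ring \<Longrightarrow> T \<in> carrier meas_ring \<Longrightarrow>
    meas_class S \<oplus>\<^bsub>meas_alg\<^esub> meas_class T = meas_class (sym_diff S T)"
  using mc.hom_add[of S T] by (simp add: meas_ring_simps(3))

lemma meas_class_empty: "meas_class {} = \<zero>\<^bsub>meas_alg\<^esub>"
  using mc.hom_zero by (simp add: meas_ring_simps)

lemma meas_class_top: "meas_class {0..1} = \<one>\<^bsub>meas_alg\<^esub>"
  using mc.hom_one by (simp add: meas_ring_simps)

lemma meas_dist_eq:
  "S \<in> carrier meas_ring \<Longrightarrow> T \<in> carrier meas_ring \<Longrightarrow>
    meas_dist (meas_class S) (meas_class T) = mu (sym_diff S T)"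
  by (simp add: meas_dist_class meas_ring_simps(3))

lemma meas_alg_idem: "X \<in> carrier meas_alg \<Longrightarrow> X \<otimes>\<^bsub>meas_alg\<^esub> X = X"
  by (elim meas_alg_cases) (simp add: meas_class_Int)

lemma meas_alg_pow:
  assumes "X \<in> carrier meas_alg" "n \<ge> 1"
  shows "X [^]\<^bsub>meas_alg\<^esub> (n::nat) = X"
  using \<open>n \<ge> 1\<close> by (induction n rule: dec_induct) (use assms(1) in \<open>simp_all add: meas_alg_idem\<close>)

text \<open>The ring has characteristic 2, since the symmetric difference of a set with itself is
  empty. Negation is therefore the identity map, with immediate continuity, and subtraction
  coincides with addition.\<close>

lemma meas_alg_minus:
  assumes "X \<in> carrier meas_alg"
  shows "\<ominus>\<^bsub>meas_alg\<^esub> X = X"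
proof -
  have "X \<oplus>\<^bsub>meas_alg\<^esub> X = \<zero>\<^bsub>meas_alg\<^esub>"
    using assms by (elim meas_alg_cases) (simp add: meas_class_sym_diff meas_class_empty)
  then show ?thesis
    using MA.minus_equality assms by blast
qed

section \<open>Continuity of the ring operations\<close>

lemma mu_le_add:
  assumes "A \<subseteq> B \<union> C" "B \<in> carrier meas_ring" "C \<in> carrier meas_ring"
  shows "mu A \<le> mu B + mu C"
proof -
  have "mu A \<le> mu (B \<union> C)"
    by (rule mu.finite_measure_mono) (use assms in \<open>auto simp: meas_ring_simps\<close>)
  also have "\<dots> \<le> mu B + mu C"
    by (rule measure_Un_le) (use assms in \<open>auto simp: meas_ring_simps\<close>)
  finally show ?thesis .
qed

lemma sym_diff_in_meas_ring:
  "S \<in> carrier meas_ring \<Longrightarrow> T \<in> carrier meas_ring \<Longrightarrow> sym_diff S T \<in> carrier meas_ring"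
  by (auto simp: meas_ring_simps)

text \<open>Whether a point lies in a symmetric difference depends only on whether it lies in each
  argument. Where the two results differ, one pair of arguments must differ, so the estimate reduces
  to an inclusion of sets. The same reasoning gives the estimate for products.\<close>

lemma meas_dist_add_le:
  assumes "X \<in> carrier meas_alg" "Y \<in> carrier meas_alg" "X' \<in> carrier meas_alg" "Y' \<in> carrier meas_alg"
  shows "meas_dist (X \<oplus>\<^bsub>meas_alg\<^esub> Y) (X' \<oplus>\<^bsub>meas_alg\<^esub> Y') \<le> meas_dist X X' + meas_dist Y Y'"
  using assms
proof (elim meas_alg_cases, hypsubst)
  fix S T S' T'
  assume *: "S \<in> carrier meas_ring" "T \<in> carrier meas_ring" "S' \<in> carrier meas_ring" "T' \<in> carrier meas_ring"
  have "mu (sym_diff (sym_diff S T) (sym_diff S' T')) \<le> mu (sym_diff S S') + mu (sym_diff T T')"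
    using * by (intro mu_le_add sym_diff_in_meas_ring) auto
  then show "meas_dist (meas_class S \<oplus>\<^bsub>meas_alg\<^esub> meas_class T) (meas_class S' \<oplus>\<^bsub>meas_alg\<^esub> meas_class T')
      \<le> meas_dist (meas_class S) (meas_class S') + meas_dist (meas_class T) (meas_class T')"
    using * by (simp add: meas_class_sym_diff meas_dist_eq sym_diff_in_meas_ring)
qed

lemma meas_dist_mult_le:
  assumes "X \<in> carrier meas_alg" "Y \<in> carrier meas_alg" "X' \<in> carrier meas_alg" "Y' \<in> carrier meas_alg"
  shows "meas_dist (X \<otimes>\<^bsub>meas_alg\<^esub> Y) (X' \<otimes>\<^bsub>meas_alg\<^esub> Y') \<le> meas_dist X X' + meas_dist Y Y'"
  using assms
proof (elim meas_alg_cases, hypsubst)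
  fix S T S' T'
  assume *: "S \<in> carrier meas_ring" "T \<in> carrier meas_ring" "S' \<in> carrier meas_ring" "T' \<in> carrier meas_ring"
  have "mu (sym_diff (S \<inter> T) (S' \<inter> T')) \<le> mu (sym_diff S S') + mu (sym_diff T T')"
    using * by (intro mu_le_add sym_diff_in_meas_ring) auto
  moreover have "S \<inter> T \<in> carrier meas_ring" "S' \<inter> T' \<in> carrier meas_ring"
    using * by (auto simp: meas_ring_simps)
  ultimately show "meas_dist (meas_class S \<otimes>\<^bsub>meas_alg\<^esub> meas_class T) (meas_class S' \<otimes>\<^bsub>meas_alg\<^esub> meas_class T')
      \<le> meas_dist (meas_class S) (meas_class S') + meas_dist (meas_class T) (meas_class T')"
    using * by (simp add: meas_class_Int meas_dist_eq)
qed

lemma topological_cring_meas_alg: "topological_cring meas_alg meas_topology"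
proof -
  have "continuous_map MA.mtopology MA.mtopology (\<lambda>X. \<ominus>\<^bsub>meas_alg\<^esub> X)"
    by (rule continuous_map_eq[OF continuous_map_id]) (simp add: meas_alg_minus)
  then show ?thesis
    unfolding topological_cring_def meas_topology_def
    by (intro conjI MA.continuous_map_prod_nonexpansive meas_dist_add_le meas_dist_mult_le)
      (simp_all add: MA.is_cring)
qed

section \<open>Completeness, for sequences and for filters\<close>

lemma limsup_diff_subset:
  fixes S :: "nat \<Rightarrow> 'a set"
  shows "sym_diff (S n) (\<Inter>m. \<Union>k\<in>{m..}. S k) \<subseteq> (\<Union>i. sym_diff (S (n + i)) (S (Suc (n + i))))"
    (is "_ \<subseteq> ?U")
proof
  fix x assume x: "x \<in> sym_diff (S n) (\<Inter>m. \<Union>k\<in>{m..}. S k)"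
  show "x \<in> ?U"
  proof (rule ccontr)
    assume "x \<notin> ?U"
    \<comment> \<open>Outside the union, membership of \<open>x\<close> never changes from stage
      \<open>n\<close> on. Then \<open>x\<close> belongs to the limit superior exactly when it
      belongs to \<open>S n\<close>, against the choice of \<open>x\<close>.\<close>
    then have step: "x \<in> S (n + i) \<longleftrightarrow> x \<in> S (Suc (n + i))" for i by blast
    have const: "x \<in> S (n + i) \<longleftrightarrow> x \<in> S n" for i
      by (induction i) (use step in auto)
    have const': "x \<in> S k \<longleftrightarrow> x \<in> S n" if "n \<le> k" for k
      using const[of "k - n"] that by simp
    show False
    proof (cases "x \<in> S n")
      case True
      then have "x \<in> S (max m n)" for m using const'[of "max m n"] by simp
      then have "x \<in> (\<Inter>m. \<Union>k\<in>{m..}. S k)"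
        by (meson INT_I UN_I atLeast_iff max.cobounded1)
      with x True show False by blast
    next
      case False
      then have "x \<notin> (\<Union>k\<in>{n..}. S k)" using const' by blast
      with x False show False by blast
    qed
  qed
qed

lemma mcomplete_meas_alg: "MA.mcomplete"
proof (rule MA.mcompleteI_fast)
  fix \<sigma> assume ran: "range \<sigma> \<subseteq> carrier meas_alg"
    and fast: "\<And>n. meas_dist (\<sigma> n) (\<sigma> (Suc n)) \<le> (1/2) ^ n"
  have "\<exists>S. S \<in> carrier meas_ring \<and> \<sigma> n = meas_class S" for n
    using ran by (auto simp: meas_alg_carrier)
  then obtain S where S: "\<And>n. S n \<in> carrier meas_ring" and \<sigma>: "\<And>n. \<sigma> n = meas_class (S n)"
    by metis
  define L where "L = (\<Inter>m. \<Union>k\<in>{m..}. S k)"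
  have L: "L \<in> carrier meas_ring"
    using S unfolding L_def meas_ring_simps by (intro sets.countable_INT sets.countable_UN') auto
  \<comment> \<open>The factor 2 is the sum of the geometric series: by countable subadditivity the
    distance is at most the sum of \<open>(1/2) ^ (n + i)\<close> over all \<open>i\<close>.\<close>
  have bound: "meas_dist (\<sigma> n) (meas_class L) \<le> 2 * (1/2) ^ n" for n
  proof -
    define D where "D i = sym_diff (S (n + i)) (S (Suc (n + i)))" for i
    have D: "D i \<in> sets (lebesgue_on {0..1})" for i
      using sym_diff_in_meas_ring[OF S S] by (simp add: D_def meas_ring_simps(1))
    have Dle: "mu (D i) \<le> (1/2) ^ n * (1/2) ^ i" for i
      using fast[of "n + i"] S by (simp add: \<sigma> meas_dist_eq D_def power_add)
    have sums: "(\<lambda>i. (1/2) ^ n * (1/2) ^ i) sums ((1/2) ^ n * 2 :: real)"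
      using sums_mult[OF geometric_sums[of "1/2::real"]] by simp
    have summ: "summable (\<lambda>i. mu (D i))"
      by (rule summable_comparison_test'[OF sums_summable[OF sums]]) (use Dle in simp)
    have "mu (sym_diff (S n) L) \<le> mu (\<Union>i. D i)"
      unfolding L_def by (rule mu.finite_measure_mono) (use limsup_diff_subset[of S n] D in \<open>auto simp: D_def\<close>)
    also have "\<dots> \<le> (\<Sum>i. mu (D i))"
      using D summ by (intro mu.finite_measure_subadditive_countably) auto
    also have "\<dots> \<le> (1/2) ^ n * 2"
      using suminf_le[OF Dle summ sums_summable[OF sums]] sums_unique[OF sums] by simp
    finally show ?thesis
      using S L by (simp add: \<sigma> meas_dist_eq mult.commute)
  qed
  have lim: "(\<lambda>n. 2 * (1/2) ^ n :: real) \<longlonglongrightarrow> 0"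
    using tendsto_mult_right_zero[OF LIMSEQ_power_zero[of "1/2::real"]] by simp
  have "limitin MA.mtopology \<sigma> (meas_class L) sequentially"
    unfolding MA.limitin_metric
  proof (intro conjI allI impI)
    show "meas_class L \<in> carrier meas_alg" using L by simp
    fix \<epsilon> :: real assume "\<epsilon> > 0"
    then have "\<forall>\<^sub>F n in sequentially. 2 * (1/2) ^ n < \<epsilon>"
      by (rule order_tendstoD(2)[OF lim])
    then show "\<forall>\<^sub>F n in sequentially. \<sigma> n \<in> carrier meas_alg \<and> meas_dist (\<sigma> n) (meas_class L) < \<epsilon>"
      by eventually_elim (use ran bound in \<open>auto intro: le_less_trans\<close>)
  qed
  then show "\<exists>l. limitin MA.mtopology \<sigma> l sequentially" ..
qed

text \<open>This is translation invariance of the metric. It identifies the entourages of the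
  additive uniformity given by balls around 0 with those of the metric.\<close>

lemma meas_dist_zero_diff:
  assumes "X \<in> carrier meas_alg" "Y \<in> carrier meas_alg"
  shows "meas_dist \<zero>\<^bsub>meas_alg\<^esub> (X \<ominus>\<^bsub>meas_alg\<^esub> Y) = meas_dist X Y"
  using assms
proof (elim meas_alg_cases, hypsubst)
  fix S T assume *: "S \<in> carrier meas_ring" "T \<in> carrier meas_ring"
  then have "meas_class S \<ominus>\<^bsub>meas_alg\<^esub> meas_class T = meas_class (sym_diff S T)"
    by (simp add: a_minus_def meas_alg_minus meas_class_sym_diff)
  moreover have "{} \<in> carrier meas_ring" by (simp add: meas_ring_simps)
  ultimately show "meas_dist \<zero>\<^bsub>meas_alg\<^esub> (meas_class S \<ominus>\<^bsub>meas_alg\<^esub> meas_class T) =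
      meas_dist (meas_class S) (meas_class T)"
    using * by (simp add: meas_class_empty[symmetric] meas_dist_eq sym_diff_in_meas_ring)
qed

text \<open>Testing the Cauchy condition on balls around 0 yields, by translation invariance, the
  metric Cauchy condition for the filter; metric completeness then supplies a limit.\<close>

lemma complete_topological_cring_meas_alg: "complete_topological_cring meas_alg meas_topology"
  unfolding complete_topological_cring_def
proof (intro conjI allI impI topological_cring_meas_alg)
  fix F assume F: "ring_cauchy_filter meas_alg meas_topology F"
  have "\<forall>\<^sub>F (X, Y) in F \<times>\<^sub>F F. X \<in> carrier meas_alg \<and> Y \<in> carrier meas_alg \<and> meas_dist X Y < \<epsilon>"
    if "\<epsilon> > 0" for \<epsilon>
  proof -
    have "openin meas_topology (MA.mball \<zero>\<^bsub>meas_alg\<^esub> \<epsilon>)" "\<zero>\<^bsub>meas_alg\<^esub> \<in> MA.mball \<zero>\<^bsub>meas_alg\<^esub> \<epsilon>"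
      using that by (simp_all add: meas_topology_def)
    then have "\<forall>\<^sub>F (X, Y) in F \<times>\<^sub>F F. X \<ominus>\<^bsub>meas_alg\<^esub> Y \<in> MA.mball \<zero>\<^bsub>meas_alg\<^esub> \<epsilon>"
      using F unfolding ring_cauchy_filter_def by blast
    moreover have "\<forall>\<^sub>F X in F. X \<in> carrier meas_alg"
      using F unfolding ring_cauchy_filter_def by blast
    then have "\<forall>\<^sub>F (X, Y) in F \<times>\<^sub>F F. X \<in> carrier meas_alg \<and> Y \<in> carrier meas_alg"
      by (auto simp: eventually_prod_same)
    ultimately show ?thesis
      by eventually_elim (auto simp: meas_dist_zero_diff)
  qed
  moreover have "F \<noteq> bot"
    using F unfolding ring_cauchy_filter_def by blast
  ultimately show "\<exists>l. limitin meas_topology (\<lambda>x. x) l F"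
    unfolding meas_topology_def
    using MA.mcomplete_imp_cauchy_filter_converges[OF mcomplete_meas_alg] by blast
qed

section \<open>The closed radical of zero and the absence of closed prime ideals\<close>

lemma closed_radical_zero_meas_alg:
  "closed_radical meas_alg meas_topology {\<zero>\<^bsub>meas_alg\<^esub>} = {\<zero>\<^bsub>meas_alg\<^esub>}"
proof -
  have "closedin meas_topology {\<zero>\<^bsub>meas_alg\<^esub>}"
    unfolding meas_topology_def
    by (rule closedin_t1_singleton) (simp_all add: MA.Hausdorff_space_mtopology Hausdorff_imp_t1_space)
  \<comment> \<open>Every positive power of an element is the element itself, so any ideal satisfies
    the power condition. Hence the zero ideal, being closed, is its own hull.\<close>
  then have "closed_radical_ideal meas_alg meas_topology {\<zero>\<^bsub>meas_alg\<^esub>}"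
    unfolding closed_radical_ideal_def using MA.zeroideal meas_alg_pow by metis
  then show ?thesis
    unfolding closed_radical_def by (rule hull_same)
qed

text \<open>Cutting with \<open>{0..1}\<close> keeps the set in the ring for every real
  \<open>a\<close>, so no bounds on the left end point have to be carried through the
  halving.\<close>

definition short_interval :: "nat \<Rightarrow> real \<Rightarrow> real set" where
  "short_interval n a = {a..a + (1/2) ^ n} \<inter> {0..1}"

lemma short_interval_in_meas_ring: "short_interval n a \<in> carrier meas_ring"
  by (simp add: short_interval_def meas_ring_simps sets_restrict_space_iff)

lemma mu_short_interval_le: "mu (short_interval n a) \<le> (1/2) ^ n"
proof -
  have "mu (short_interval n a) = measure lebesgue (short_interval n a)"
    by (rule measure_restrict_space) (auto simp: short_interval_def)
  also have "\<dots> \<le> measure lebesgue {a..a + (1/2) ^ n}"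
    by (rule measure_mono_fmeasurable) (auto simp: short_interval_def)
  finally show ?thesis by simp
qed

text \<open>The class of a union is a ring expression in the classes of its two parts. If both
  halves of an interval had their classes in \<open>P\<close>, the whole interval would too; so at
  least one half stays outside, starting from the unit.\<close>

lemma exists_short_interval_not_in_proper_ideal:
  assumes P: "ideal P meas_alg" and one: "\<one>\<^bsub>meas_alg\<^esub> \<notin> P"
  shows "\<exists>a. meas_class (short_interval n a) \<notin> P"
proof (induction n)
  case 0
  have "short_interval 0 0 = {0..1}" by (auto simp: short_interval_def)
  then show ?case using one by (metis meas_class_top)
next
  case (Suc n)
  interpret P: ideal P meas_alg by (rule P)
  obtain a where a: "meas_class (short_interval n a) \<notin> P" using Suc by blast
  define b where "b = a + (1/2) ^ Suc n"
  let ?S = "short_interval (Suc n) a" and ?T = "short_interval (Suc n) b"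
  note S = short_interval_in_meas_ring[of "Suc n" a] and T = short_interval_in_meas_ring[of "Suc n" b]
  \<comment> \<open>Naming the half length turns the splitting into a statement of linear arithmetic
    about \<open>h\<close> and \<open>2 * h\<close>.\<close>
  define h :: real where "h = (1/2) ^ Suc n"
  have "h > 0" "(1/2) ^ n = 2 * h" by (simp_all add: h_def)
  then have "short_interval n a = ?S \<union> ?T"
    unfolding short_interval_def b_def h_def[symmetric] by auto
  \<comment> \<open>The Boolean identity for the union of \<open>S\<close> and \<open>T\<close> is
    \<open>S + T + S T\<close>. The product term is present because the closed halves can share an
    end point.\<close>
  also have "\<dots> = sym_diff (sym_diff ?S ?T) (?S \<inter> ?T)" by blast
  also have "meas_class \<dots> =
      (meas_class ?S \<oplus>\<^bsub>meas_alg\<^esub> meas_class ?T) \<oplus>\<^bsub>meas_alg\<^esub> meas_class ?S \<otimes>\<^bsub>meas_alg\<^esub> meas_class ?T"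
    using S T MR.m_closed[OF S T]
    by (simp add: meas_class_sym_diff meas_class_Int sym_diff_in_meas_ring meas_ring_simps(2))
  finally have "meas_class ?S \<notin> P \<or> meas_class ?T \<notin> P"
    using a S T by (metis P.I_r_closed P.a_closed mc.hom_closed)
  then show ?case by blast
qed

lemma no_closed_prime_ideal_meas_alg: "\<not> closed_prime_ideal meas_alg meas_topology P"
proof
  assume "closed_prime_ideal meas_alg meas_topology P"
  then have prime: "primeideal P meas_alg" and closed: "closedin MA.mtopology P"
    by (simp_all add: closed_prime_ideal_def meas_topology_def)
  interpret P: primeideal P meas_alg by (rule prime)
  have one: "\<one>\<^bsub>meas_alg\<^esub> \<notin> P"
    using P.one_imp_carrier P.I_notcarr by blast
  \<comment> \<open>The left end points are chosen separately for each \<open>n\<close>; the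
    intervals need not be nested, as only their lengths enter below.\<close>
  obtain a where a: "\<And>n. meas_class (short_interval n (a n)) \<notin> P"
    using exists_short_interval_not_in_proper_ideal[OF P.is_ideal one] by metis
  define S where "S n = short_interval n (a n)" for n
  define T where "T n = {0..1} - S n" for n
  have S: "S n \<in> carrier meas_ring" for n
    by (simp add: S_def short_interval_in_meas_ring)
  have T: "T n \<in> carrier meas_ring" for n
    using S[of n] meas_ring_top by (auto simp: T_def meas_ring_simps)
  \<comment> \<open>The product of the two classes is 0 and thus in \<open>P\<close>, while the
    class of \<open>S n\<close> is not; primeness leaves the complement.\<close>
  have TP: "meas_class (T n) \<in> P" for n
  proof -
    have "S n \<inter> T n = {}" by (auto simp: T_def)
    then have "meas_class (S n) \<otimes>\<^bsub>meas_alg\<^esub> meas_class (T n) = \<zero>\<^bsub>meas_alg\<^esub>"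
      using S T by (simp add: meas_class_Int meas_class_empty)
    then show ?thesis
      using P.I_prime[of "meas_class (S n)" "meas_class (T n)"] a S T S_def by auto
  qed
  \<comment> \<open>The sum of \<open>T n\<close> and the whole interval is \<open>S n\<close>, so
    the distance to 1 is the measure of \<open>S n\<close>.\<close>
  have dist: "meas_dist (meas_class (T n)) \<one>\<^bsub>meas_alg\<^esub> \<le> (1/2) ^ n" for n
  proof -
    have "sym_diff (T n) {0..1} = S n"
      using meas_ring_subset[OF S] by (auto simp: T_def)
    then show ?thesis
      using mu_short_interval_le[of n "a n"] meas_dist_eq[OF T meas_ring_top]
      by (simp add: meas_class_top S_def)
  qed
  have "limitin MA.mtopology (\<lambda>n. meas_class (T n)) \<one>\<^bsub>meas_alg\<^esub> sequentially"
    unfolding MA.limitin_metric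
  proof (intro conjI allI impI)
    fix \<epsilon> :: real assume "\<epsilon> > 0"
    then have "\<forall>\<^sub>F n in sequentially. (1/2) ^ n < \<epsilon>"
      by (intro order_tendstoD(2)[OF LIMSEQ_power_zero]) simp_all
    then show "\<forall>\<^sub>F n in sequentially.
        meas_class (T n) \<in> carrier meas_alg \<and> meas_dist (meas_class (T n)) \<one>\<^bsub>meas_alg\<^esub> < \<epsilon>"
      by eventually_elim (use T dist in \<open>auto intro: le_less_trans\<close>)
  qed simp
  then have "\<one>\<^bsub>meas_alg\<^esub> \<in> P"
    by (rule limitin_closedin[OF _ closed]) (simp_all add: TP)
  with one show False ..
qed

text \<open>Nontriviality, from the unit interval having measure 1. It is what separates the radical
  \<open>{0}\<close> from the intersection of the empty family, which is the whole ring.\<close>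

lemma meas_alg_one_not_zero: "\<one>\<^bsub>meas_alg\<^esub> \<noteq> \<zero>\<^bsub>meas_alg\<^esub>"
proof -
  have "mu {0..1} = 1"
    by (simp add: measure_restrict_space)
  moreover have "{} \<in> carrier meas_ring" by (simp add: meas_ring_simps)
  ultimately have "meas_class {0..1} \<noteq> meas_class {}"
    by (simp add: meas_class_eq_iff meas_ring_top meas_ring_simps(3))
  then show ?thesis by (simp add: meas_class_top meas_class_empty)
qed

theorem mainTheorem2:
  shows "topological_cring meas_alg meas_topology
     \<and> (\<forall>x\<in>carrier meas_alg. x \<otimes>\<^bsub>meas_alg\<^esub> x = x)
     \<and> Metric_space (carrier meas_alg) meas_dist
     \<and> Metric_space.mcomplete (carrier meas_alg) meas_dist
     \<and> closed_radical meas_alg meas_topology {\<zero>\<^bsub>meas_alg\<^esub>} = {\<zero>\<^bsub>meas_alg\<^esub>}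
     \<and> \<not> (\<exists>P. closed_prime_ideal meas_alg meas_topology P)
     \<and> closed_radical meas_alg meas_topology {\<zero>\<^bsub>meas_alg\<^esub>}
         \<noteq> closed_prime_intersection meas_alg meas_topology {\<zero>\<^bsub>meas_alg\<^esub>}
     \<and> \<not> (\<forall>(R :: real set set ring) T. complete_topological_cring R T \<longrightarrow>
            (\<forall>I. ideal I R \<longrightarrow> closed_radical R T I = closed_prime_intersection R T I))"
proof -
  have "closed_prime_intersection meas_alg meas_topology {\<zero>\<^bsub>meas_alg\<^esub>} = carrier meas_alg"
    by (simp add: closed_prime_intersection_def no_closed_prime_ideal_meas_alg)
  then have neq: "closed_radical meas_alg meas_topology {\<zero>\<^bsub>meas_alg\<^esub>}
      \<noteq> closed_prime_intersection meas_alg meas_topology {\<zero>\<^bsub>meas_alg\<^esub>}"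
    using closed_radical_zero_meas_alg meas_alg_one_not_zero MA.one_closed by auto
  \<comment> \<open>The quantified rings have elements of type \<open>real set set\<close>, the type
    of the cosets; the refuting instance is \<open>meas_alg\<close> with its zero ideal.\<close>
  then have "\<not> (\<forall>(R :: real set set ring) T. complete_topological_cring R T \<longrightarrow>
      (\<forall>I. ideal I R \<longrightarrow> closed_radical R T I = closed_prime_intersection R T I))"
    using complete_topological_cring_meas_alg MA.zeroideal by blast
  with neq show ?thesis
    using topological_cring_meas_alg meas_alg_idem Metric_space_meas_alg mcomplete_meas_alg
      closed_radical_zero_meas_alg no_closed_prime_ideal_meas_alg by blast
qed

end
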